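(* Let $\Omega$ be a completely regular Hausdorff Baire space and let $(f_\alpha)$ be a net in $C(\Omega)$. If $(f_\alpha)$ is uo-Cauchy in $C(\Omega)$, then there is a co-meagre set $D\subseteq\Omega$ such that $\lim_\alpha f_\alpha(t)$ exists in $\mathbb R$ for every $t\in D$. The converse is true for countable nets: if the index set of $(f_\alpha)$ is countable and $\lim_\alpha f_\alpha(t)$ exists in $\mathbb R$ for every $t$ in some co-meagre set, then $(f_\alpha)$ is uo-Cauchy in $C(\Omega)$.
   Context: $C(\Omega)$ is the vector lattice of all real-valued continuous functions on $\Omega$ with pointwise operations and order. A net $(x_\alpha)$ in a vector lattice $X$ converges in order to $x$ if there is a net $(u_\gamma)$ in $X$, possibly with a different index set, such that $u_\gamma\downarrow 0$ (decreasing with infimum $0$ in $X$) and for every $\gamma$ there exists $\alpha_0$ with $|x_\alpha-x|\leqslant u_\gamma$ for all $\alpha\geqslant\alpha_0$. The net uo-converges to $x$ if for every $u\geqslant 0$ in $X$ the net $(|x_\alpha-x|\wedge u)$ converges in order to $0$. A net $(x_\alpha)_{\alpha\in\Lambda}$ is uo-Cauchy if the double net $(x_\alpha-x_\beta)$, indexed by $(\alpha,\beta)\in\Lambda^2$ with the coordinatewise order, uo-converges to $0$. A set is nowhere dense if its closure has empty interior, meagre if it is a countable union of nowhere dense sets, and co-meagre if its complement is meagre. A Baire space is a topological space in which every countable intersection of dense open sets is dense. *)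

theory Defs
  imports "HOL-Analysis.Analysis" "HOL-Library.Lattice_Algebras"
begin

section \<open>Nets\<close>

text \<open>
  A net is a function restricted to an index set \<open>I\<close> that is directed by a preorder \<open>le\<close>,
  where \<open>le a b\<close> means that \<open>b\<close> is the later index.
\<close>

definition directed_set :: "'i set \<Rightarrow> ('i \<Rightarrow> 'i \<Rightarrow> bool) \<Rightarrow> bool" where
  "directed_set I le \<longleftrightarrow>
     I \<noteq> {} \<and> reflp_on I le \<and> transp_on I le \<and> (\<forall>a\<in>I. \<forall>b\<in>I. \<exists>c\<in>I. le a c \<and> le b c)"

definition net_filter :: "'i set \<Rightarrow> ('i \<Rightarrow> 'i \<Rightarrow> bool) \<Rightarrow> 'i filter" where
  "net_filter I le = (INF a\<in>I. principal {b\<in>I. le a b})"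

lemma eventually_net_filter:
  assumes "directed_set I le"
  shows "eventually P (net_filter I le) \<longleftrightarrow> (\<exists>a\<in>I. \<forall>b\<in>I. le a b \<longrightarrow> P b)"
proof -
  have "eventually P (net_filter I le) \<longleftrightarrow> (\<exists>a\<in>I. eventually P (principal {b\<in>I. le a b}))"
    unfolding net_filter_def
  proof (rule eventually_INF_base)
    show "I \<noteq> {}" using assms by (simp add: directed_set_def)
    fix a b assume ab: "a \<in> I" "b \<in> I"
    then obtain c where c: "c \<in> I" "le a c" "le b c"
      using assms unfolding directed_set_def by blast
    have "transp_on I le" using assms by (simp add: directed_set_def)
    then have "{d\<in>I. le c d} \<subseteq> {d\<in>I. le a d} \<inter> {d\<in>I. le b d}"
      using ab c by (auto dest: transp_onD)
    then show "\<exists>c\<in>I. principal {d\<in>I. le c d} \<le>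
        inf (principal {d\<in>I. le a d}) (principal {d\<in>I. le b d})"
      using c(1) by auto
  qed
  then show ?thesis by (auto simp: eventually_principal)
qed

lemma directed_set_prod:
  assumes "directed_set I le" "directed_set J le'"
  shows "directed_set (I \<times> J) (rel_prod le le')"
  unfolding directed_set_def
proof (intro conjI ballI)
  show "I \<times> J \<noteq> {}" using assms by (simp add: directed_set_def)
  show "reflp_on (I \<times> J) (rel_prod le le')"
    using assms by (simp add: directed_set_def reflp_on_def)
  have "transp_on I le" "transp_on J le'" using assms by (simp_all add: directed_set_def)
  then show "transp_on (I \<times> J) (rel_prod le le')"
    by (intro transp_onI) (auto dest: transp_onD)
  fix p q assume "p \<in> I \<times> J" "q \<in> I \<times> J"
  then obtain a b c d where ab: "p = (a, b)" "q = (c, d)" "a \<in> I" "b \<in> J" "c \<in> I" "d \<in> J"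
    by blast
  obtain e where "e \<in> I" "le a e" "le c e"
    using assms(1) ab unfolding directed_set_def by blast
  moreover obtain e' where "e' \<in> J" "le' b e'" "le' d e'"
    using assms(2) ab unfolding directed_set_def by blast
  ultimately show "\<exists>r\<in>I \<times> J. rel_prod le le' p r \<and> rel_prod le le' q r"
    using ab(1,2) by (intro bexI[of _ "(e, e')"]) simp_all
qed

section \<open>Order convergence in vector lattices\<close>

class vector_lattice = ordered_real_vector + lattice_ab_group_add_abs

definition decreases_to_zero ::
    "'j set \<Rightarrow> ('j \<Rightarrow> 'j \<Rightarrow> bool) \<Rightarrow> ('j \<Rightarrow> 'x::vector_lattice) \<Rightarrow> bool" where
  "decreases_to_zero J le u \<longleftrightarrow>
     (\<forall>c\<in>J. \<forall>d\<in>J. le c d \<longrightarrow> u d \<le> u c) \<and>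
     (\<forall>c\<in>J. 0 \<le> u c) \<and> (\<forall>v. (\<forall>c\<in>J. v \<le> u c) \<longrightarrow> v \<le> 0)"

text \<open>
  The dominating net may have an arbitrary index set. Since HOL cannot quantify over types
  inside a formula, its index set is taken in the vector lattice itself. This loses nothing, as
  a decreasing net can be reindexed by its own range with the reversed order; see
  \<open>order_convergesI\<close> below.
\<close>

definition order_converges ::
    "'i set \<Rightarrow> ('i \<Rightarrow> 'i \<Rightarrow> bool) \<Rightarrow> ('i \<Rightarrow> 'x::vector_lattice) \<Rightarrow> 'x \<Rightarrow> bool" where
  "order_converges I le x l \<longleftrightarrow>
     (\<exists>(J::'x set) le' u. directed_set J le' \<and> decreases_to_zero J le' u \<and>
        (\<forall>c\<in>J. \<exists>a\<in>I. \<forall>b\<in>I. le a b \<longrightarrow> \<bar>x b - l\<bar> \<le> u c))"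

lemma order_convergesI:
  fixes J :: "'j set" and u :: "'j \<Rightarrow> 'x::vector_lattice"
  assumes J: "directed_set J le'" and u: "decreases_to_zero J le' u"
    and dom: "\<And>c. c \<in> J \<Longrightarrow> \<exists>a\<in>I. \<forall>b\<in>I. le a b \<longrightarrow> \<bar>x b - l\<bar> \<le> u c"
  shows "order_converges I le x l"
  unfolding order_converges_def
proof (intro exI conjI)
  show "directed_set (u ` J) (\<lambda>v w. w \<le> v)"
    unfolding directed_set_def
  proof (intro conjI ballI)
    show "u ` J \<noteq> {}" using J by (simp add: directed_set_def)
    show "reflp_on (u ` J) (\<lambda>v w. w \<le> v)" by (simp add: reflp_on_def)
    show "transp_on (u ` J) (\<lambda>v w. w \<le> v)" by (auto simp: transp_on_def)
    fix v w assume "v \<in> u ` J" "w \<in> u ` J"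
    then obtain c d where cd: "c \<in> J" "d \<in> J" "v = u c" "w = u d" by blast
    then obtain e where "e \<in> J" "le' c e" "le' d e"
      using J unfolding directed_set_def by blast
    then show "\<exists>z\<in>u ` J. z \<le> v \<and> z \<le> w"
      using u cd unfolding decreases_to_zero_def by blast
  qed
  show "decreases_to_zero (u ` J) (\<lambda>v w. w \<le> v) id"
    using u by (auto simp: decreases_to_zero_def)
  show "\<forall>c\<in>u ` J. \<exists>a\<in>I. \<forall>b\<in>I. le a b \<longrightarrow> \<bar>x b - l\<bar> \<le> id c"
    using dom by auto
qed

definition uo_converges ::
    "'i set \<Rightarrow> ('i \<Rightarrow> 'i \<Rightarrow> bool) \<Rightarrow> ('i \<Rightarrow> 'x::vector_lattice) \<Rightarrow> 'x \<Rightarrow> bool" where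
  "uo_converges I le x l \<longleftrightarrow> (\<forall>u\<ge>0. order_converges I le (\<lambda>a. inf \<bar>x a - l\<bar> u) 0)"

definition uo_Cauchy ::
    "'i set \<Rightarrow> ('i \<Rightarrow> 'i \<Rightarrow> bool) \<Rightarrow> ('i \<Rightarrow> 'x::vector_lattice) \<Rightarrow> bool" where
  "uo_Cauchy I le x \<longleftrightarrow> uo_converges (I \<times> I) (rel_prod le le) (\<lambda>(a, b). x a - x b) 0"

section \<open>The vector lattice of continuous real-valued functions\<close>

typedef (overloaded) 'a cfun = "{f :: 'a::topological_space \<Rightarrow> real. continuous_on UNIV f}"
  morphisms apply_cfun Cfun
  by (rule exI[of _ "\<lambda>_. 0"]) simp

setup_lifting type_definition_cfun

lemma continuous_on_apply_cfun [simp]: "continuous_on UNIV (apply_cfun f)"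
  using apply_cfun[of f] by simp

instantiation cfun :: (topological_space) vector_lattice
begin

lift_definition zero_cfun :: "'a cfun" is "\<lambda>_. 0"
  by simp
lift_definition plus_cfun :: "'a cfun \<Rightarrow> 'a cfun \<Rightarrow> 'a cfun" is "\<lambda>f g t. f t + g t"
  by (rule continuous_on_add)
lift_definition minus_cfun :: "'a cfun \<Rightarrow> 'a cfun \<Rightarrow> 'a cfun" is "\<lambda>f g t. f t - g t"
  by (rule continuous_on_diff)
lift_definition uminus_cfun :: "'a cfun \<Rightarrow> 'a cfun" is "\<lambda>f t. - f t"
  by (rule continuous_on_minus)
lift_definition scaleR_cfun :: "real \<Rightarrow> 'a cfun \<Rightarrow> 'a cfun" is "\<lambda>r f t. r * f t"
  by (rule continuous_on_mult_left)
lift_definition less_eq_cfun :: "'a cfun \<Rightarrow> 'a cfun \<Rightarrow> bool" is "\<lambda>f g. \<forall>t. f t \<le> g t" .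
definition less_cfun :: "'a cfun \<Rightarrow> 'a cfun \<Rightarrow> bool" where
  "less_cfun f g \<longleftrightarrow> f \<le> g \<and> \<not> g \<le> f"
lift_definition sup_cfun :: "'a cfun \<Rightarrow> 'a cfun \<Rightarrow> 'a cfun" is "\<lambda>f g t. max (f t) (g t)"
  by (rule continuous_on_max)
lift_definition inf_cfun :: "'a cfun \<Rightarrow> 'a cfun \<Rightarrow> 'a cfun" is "\<lambda>f g t. min (f t) (g t)"
  by (rule continuous_on_min)
lift_definition abs_cfun :: "'a cfun \<Rightarrow> 'a cfun" is "\<lambda>f t. \<bar>f t\<bar>"
  by (rule continuous_on_rabs)

instance
proof
  fix f g h :: "'a cfun" and r s :: real
  show "f + g + h = f + (g + h)" by transfer (simp add: add.assoc)
  show "f + g = g + f" by transfer (simp add: add.commute)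
  show "0 + f = f" by transfer simp
  show "- f + f = 0" by transfer simp
  show "f - g = f + - g" by transfer simp
  show "r *\<^sub>R (f + g) = r *\<^sub>R f + r *\<^sub>R g" by transfer (simp add: distrib_left)
  show "(r + s) *\<^sub>R f = r *\<^sub>R f + s *\<^sub>R f" by transfer (simp add: distrib_right)
  show "r *\<^sub>R s *\<^sub>R f = (r * s) *\<^sub>R f" by transfer (simp add: mult.assoc)
  show "1 *\<^sub>R f = f" by transfer simp
  show "f < g \<longleftrightarrow> f \<le> g \<and> \<not> g \<le> f" by (rule less_cfun_def)
  show "f \<le> f" by transfer simp
  show "f \<le> g \<Longrightarrow> g \<le> h \<Longrightarrow> f \<le> h" by transfer (meson order_trans)
  show "f \<le> g \<Longrightarrow> g \<le> f \<Longrightarrow> f = g" by transfer (auto intro: order_antisym)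
  show "f \<le> g \<Longrightarrow> h + f \<le> h + g" by transfer simp
  show "f \<le> g \<Longrightarrow> 0 \<le> r \<Longrightarrow> r *\<^sub>R f \<le> r *\<^sub>R g" by transfer (simp add: mult_left_mono)
  show "r \<le> s \<Longrightarrow> 0 \<le> f \<Longrightarrow> r *\<^sub>R f \<le> s *\<^sub>R f" by transfer (simp add: mult_right_mono)
  show "inf f g \<le> f" by transfer simp
  show "inf f g \<le> g" by transfer simp
  show "f \<le> g \<Longrightarrow> f \<le> h \<Longrightarrow> f \<le> inf g h" by transfer simp
  show "f \<le> sup f g" by transfer simp
  show "g \<le> sup f g" by transfer simp
  show "g \<le> f \<Longrightarrow> h \<le> f \<Longrightarrow> sup g h \<le> f" by transfer simp
  show "\<bar>f\<bar> = sup f (- f)" by transfer (auto simp: max_def)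
qed

end

section \<open>Baire category\<close>

definition nowhere_dense :: "'a::topological_space set \<Rightarrow> bool" where
  "nowhere_dense S \<longleftrightarrow> interior (closure S) = {}"

definition meagre :: "'a::topological_space set \<Rightarrow> bool" where
  "meagre S \<longleftrightarrow> (\<exists>\<A>. countable \<A> \<and> (\<forall>A\<in>\<A>. nowhere_dense A) \<and> S = \<Union>\<A>)"

definition comeagre :: "'a::topological_space set \<Rightarrow> bool" where
  "comeagre D \<longleftrightarrow> meagre (- D)"

definition baire_space :: "'a::topological_space itself \<Rightarrow> bool" where
  "baire_space TYPE('a) \<longleftrightarrow>
     (\<forall>\<G>::'a set set. countable \<G> \<and> (\<forall>U\<in>\<G>. open U \<and> closure U = UNIV) \<longrightarrow> closure (\<Inter>\<G>) = UNIV)"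

end

theory Submission
  imports Defs
begin

text \<open>
  Both directions rest on bump functions, which complete regularity provides: they turn a bound
  on a nonempty open set into an inequality between elements of \<open>C(\<Omega>)\<close>.

  If the net is uo-Cauchy, truncating the differences at the constant function \<open>1\<close> gives
  dominators \<open>u\<^sub>\<gamma> \<down> 0\<close>. For each \<open>\<epsilon> > 0\<close> the open set where some \<open>u\<^sub>\<gamma>\<close> is below \<open>\<epsilon>\<close> is
  dense, as otherwise a small multiple of a bump would be a positive lower bound of all \<open>u\<^sub>\<gamma>\<close>.
  Intersecting over \<open>\<epsilon> = 1/(n+1)\<close> gives a co-meagre set on which the infimum of the \<open>u\<^sub>\<gamma>\<close> is
  pointwise zero (\<open>decreases_to_zero_pointwise_comeagre\<close>). There the net of real numbers
  \<open>f\<^sub>\<alpha>(t)\<close> is Cauchy: truncation at \<open>1\<close> does not affect differences smaller than \<open>1\<close>.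

  Conversely, let a countable net converge on a co-meagre set and fix \<open>u \<ge> 0\<close>. The
  natural candidate for a dominating net is the set \<open>V\<close> of all continuous \<open>v \<ge> 0\<close> that bound a
  tail of \<open>|f\<^sub>\<beta> - f\<^sub>\<gamma>| \<and> u\<close>, ordered downwards; what must be shown is that its infimum
  is zero. The closed sets on which all differences beyond \<open>\<alpha>\<close> are at most \<open>\<epsilon>\<close>
  cover a co-meagre set, and there are countably many of them, so by Baire category their interiors
  have dense union (\<open>baire_closed_cover\<close>). A continuous function that equals \<open>\<epsilon>\<close> at a point
  of such an interior and is at least \<open>u\<close> outside it belongs to \<open>V\<close>, so no lower bound of \<open>V\<close>
  can exceed \<open>\<epsilon>\<close> on a nonempty open set.
\<close>

section \<open>Nets of real numbers\<close>

lemma convergent_net_iff_Cauchy: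
  fixes x :: "'i \<Rightarrow> real"
  assumes dir: "directed_set I le"
  shows "(\<exists>L. (x \<longlongrightarrow> L) (net_filter I le)) \<longleftrightarrow>
    (\<forall>e>0. \<exists>a\<in>I. \<forall>b\<in>I. \<forall>c\<in>I. le a b \<longrightarrow> le a c \<longrightarrow> \<bar>x b - x c\<bar> < e)"
    (is "?conv \<longleftrightarrow> ?Cauchy")
proof
  assume ?conv
  then obtain L where L: "(x \<longlongrightarrow> L) (net_filter I le)" ..
  show ?Cauchy
  proof (intro allI impI)
    fix e :: real assume "e > 0"
    then have "eventually (\<lambda>b. dist (x b) L < e / 2) (net_filter I le)"
      using L by (intro tendstoD) simp_all
    then obtain a where a: "a \<in> I" "\<And>b. b \<in> I \<Longrightarrow> le a b \<Longrightarrow> dist (x b) L < e / 2"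
      unfolding eventually_net_filter[OF dir] by blast
    have "\<bar>x b - x c\<bar> < e" if "b \<in> I" "c \<in> I" "le a b" "le a c" for b c
      using a(2)[of b] a(2)[of c] that unfolding dist_real_def by linarith
    then show "\<exists>a\<in>I. \<forall>b\<in>I. \<forall>c\<in>I. le a b \<longrightarrow> le a c \<longrightarrow> \<bar>x b - x c\<bar> < e"
      using a(1) by blast
  qed
next
  assume C: ?Cauchy
  let ?F = "filtermap x (net_filter I le)"
  have "\<not> eventually (\<lambda>_. False) (net_filter I le)"
    using dir unfolding eventually_net_filter[OF dir] directed_set_def reflp_on_def by blast
  then have "net_filter I le \<noteq> bot" by (auto simp: trivial_limit_def)
  then have "?F \<noteq> bot" by (simp add: filtermap_bot_iff)
  moreover have "cauchy_filter ?F"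
    unfolding cauchy_filter_metric_filtermap
  proof (intro allI impI)
    fix e :: real assume "e > 0"
    then obtain a where a: "a \<in> I"
      "\<forall>b\<in>I. \<forall>c\<in>I. le a b \<longrightarrow> le a c \<longrightarrow> \<bar>x b - x c\<bar> < e"
      using C by blast
    show "\<exists>P. eventually P (net_filter I le) \<and> (\<forall>b c. P b \<and> P c \<longrightarrow> dist (x b) (x c) < e)"
      using a by (intro exI[of _ "\<lambda>b. b \<in> I \<and> le a b"])
        (auto simp: eventually_net_filter[OF dir] dist_real_def)
  qed
  ultimately have "\<exists>L\<in>UNIV. ?F \<le> nhds L"
    using complete_UNIV[where 'a = real] unfolding complete_uniform by simp
  then show ?conv
    by (simp add: filterlim_def)
qed

section \<open>Bump functions and Baire category\<close>

lemma completely_regular_bump: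
  fixes U :: "'a::topological_space set"
  assumes "completely_regular_space (euclidean :: 'a topology)" "open U" "t \<in> U"
  obtains g :: "'a cfun"
  where "\<And>s. 0 \<le> apply_cfun g s" "\<And>s. apply_cfun g s \<le> 1"
    "apply_cfun g t = 1" "\<And>s. s \<notin> U \<Longrightarrow> apply_cfun g s = 0"
proof -
  obtain h :: "'a \<Rightarrow> real" where h: "continuous_map euclidean (top_of_set {0..1}) h"
    "h t = 0" "h ` (- U) \<subseteq> {1}"
    using assms unfolding completely_regular_space_def
    by (metis DiffI Compl_iff closed_Compl closed_closedin topspace_euclidean UNIV_I)
  have cont: "continuous_on UNIV (\<lambda>s. 1 - h s)" and range: "h s \<in> {0..1}" for s
    using h(1) by (auto simp: continuous_map_in_subtopology intro!: continuous_intros)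
  have app: "apply_cfun (Cfun (\<lambda>s. 1 - h s)) = (\<lambda>s. 1 - h s)"
    using cont by (simp add: Cfun_inverse)
  show thesis
    by (rule that[of "Cfun (\<lambda>s. 1 - h s)"]) (use h(2,3) range in \<open>auto simp: app\<close>)
qed

lemma comeagre_INT_open_dense:
  assumes "\<And>n::nat. open (U n)" "\<And>n. closure (U n) = UNIV"
  shows "comeagre (\<Inter>n. U n)"
  unfolding comeagre_def meagre_def nowhere_dense_def
proof (intro exI conjI)
  show "countable (range (\<lambda>n. - U n))" by simp
  show "\<forall>A\<in>range (\<lambda>n. - U n). interior (closure A) = {}"
    using assms by (auto simp: closure_closed closed_Compl interior_complement)
  show "- (\<Inter>n. U n) = \<Union> (range (\<lambda>n. - U n))" by auto
qed

text \<open>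
  The frontier of a closed set is nowhere dense. A point that avoids the frontiers of all
  \<open>F a\<close> and the closures of the nowhere dense sets making up the complement of \<open>D\<close> lies in some
  \<open>F a\<close>, hence in its interior; by the Baire property such points are dense.
\<close>
lemma baire_closed_cover:
  fixes F :: "'i \<Rightarrow> 'a::topological_space set"
  assumes baire: "baire_space TYPE('a)" and D: "comeagre D"
    and I: "countable I" and F: "\<And>a. a \<in> I \<Longrightarrow> closed (F a)"
    and cover: "D \<subseteq> (\<Union>a\<in>I. F a)"
  shows "closure (\<Union>a\<in>I. interior (F a)) = UNIV"
proof -
  obtain \<A> where \<A>: "countable \<A>" "\<And>A. A \<in> \<A> \<Longrightarrow> nowhere_dense A" "- D = \<Union>\<A>"
    using D unfolding comeagre_def meagre_def by blast
  define \<G> where "\<G> = (\<lambda>A. - closure A) ` \<A> \<union> (\<lambda>a. - frontier (F a)) ` I"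
  have "countable \<G>"
    using \<A>(1) I by (simp add: \<G>_def)
  moreover have "open U \<and> closure U = UNIV" if "U \<in> \<G>" for U
  proof -
    have "interior (frontier (F a)) = {}" if "a \<in> I" for a
    proof -
      have "interior (frontier (F a)) \<subseteq> interior (F a)"
        using F[OF that] by (simp add: frontier_def interior_mono)
      moreover have "interior (frontier (F a)) \<inter> interior (F a) = {}"
        using interior_subset[of "frontier (F a)"] by (auto simp: frontier_def)
      ultimately show ?thesis by blast
    qed
    then show ?thesis
      using that \<A>(2) unfolding \<G>_def nowhere_dense_def
      by (elim UnE imageE) (simp_all add: closure_complement open_Compl)
  qed
  ultimately have dense: "closure (\<Inter>\<G>) = UNIV"
    using baire unfolding baire_space_def by blast
  have "\<Inter>\<G> \<subseteq> (\<Union>a\<in>I. interior (F a))"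
  proof
    fix t assume t: "t \<in> \<Inter>\<G>"
    have "t \<notin> A" if "A \<in> \<A>" for A
      using t that closure_subset[of A] unfolding \<G>_def by blast
    then have "t \<in> D" using \<A>(3) by blast
    then obtain a where a: "a \<in> I" "t \<in> F a" using cover by blast
    then have "t \<notin> frontier (F a)" using t unfolding \<G>_def by blast
    then have "t \<in> interior (F a)"
      using a F[OF a(1)] by (simp add: frontier_def)
    then show "t \<in> (\<Union>a\<in>I. interior (F a))" using a(1) by blast
  qed
  from closure_mono[OF this] show ?thesis using dense by blast
qed

section \<open>From the uo-Cauchy property to pointwise convergence\<close>

text \<open>
  An infimum in \<open>C(\<Omega>)\<close> need not be the pointwise infimum, but for a completely regular
  \<open>\<Omega>\<close> the two can differ only on a meagre set: if all \<open>u c\<close> were at least \<open>e > 0\<close> on a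
  nonempty open set, then \<open>e\<close> times a bump supported there would be a lower bound in
  \<open>C(\<Omega>)\<close> that is not below zero.
\<close>
lemma decreases_to_zero_pointwise_comeagre:
  fixes u :: "'j \<Rightarrow> 'a::topological_space cfun"
  assumes cr: "completely_regular_space (euclidean :: 'a topology)"
    and u: "decreases_to_zero J le u"
  shows "comeagre {t. \<forall>e>0. \<exists>c\<in>J. apply_cfun (u c) t < e}"
proof -
  define U where "U e = {t. \<exists>c\<in>J. apply_cfun (u c) t < e}" for e
  have "open (U e)" for e
  proof -
    have "U e = (\<Union>c\<in>J. {t. apply_cfun (u c) t < e})" by (auto simp: U_def)
    then show ?thesis by (auto intro!: open_Collect_less continuous_intros)
  qed
  moreover have "closure (U e) = UNIV" if "e > 0" for e
  proof (rule ccontr)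
    assume "closure (U e) \<noteq> UNIV"
    then obtain t where "t \<in> - closure (U e)" by blast
    then obtain g where g: "\<And>s. 0 \<le> apply_cfun g s" "\<And>s. apply_cfun g s \<le> 1"
      "apply_cfun g t = 1" "\<And>s. s \<notin> - closure (U e) \<Longrightarrow> apply_cfun g s = 0"
      using completely_regular_bump[OF cr, of "- closure (U e)" t] by blast
    have "e *\<^sub>R g \<le> u c" if c: "c \<in> J" for c
    proof -
      have "e * apply_cfun g s \<le> apply_cfun (u c) s" for s
      proof (cases "s \<in> U e")
        case True
        then have "apply_cfun g s = 0" using g(4) closure_subset by blast
        moreover have "0 \<le> u c" using u c by (simp add: decreases_to_zero_def)
        ultimately show ?thesis by (simp add: less_eq_cfun.rep_eq zero_cfun.rep_eq)
      next
        case False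
        then have "e \<le> apply_cfun (u c) s" using c by (auto simp: U_def not_less)
        moreover have "e * apply_cfun g s \<le> e * 1"
          using g(2) \<open>e > 0\<close> by (intro mult_left_mono) auto
        ultimately show ?thesis by simp
      qed
      then show ?thesis by (simp add: less_eq_cfun.rep_eq scaleR_cfun.rep_eq)
    qed
    then have "e *\<^sub>R g \<le> 0" using u by (simp add: decreases_to_zero_def)
    then have "e * apply_cfun g t \<le> 0"
      by (simp add: less_eq_cfun.rep_eq scaleR_cfun.rep_eq zero_cfun.rep_eq)
    then show False using g(3) \<open>e > 0\<close> by simp
  qed
  ultimately have "comeagre (\<Inter>n. U (inverse (real (Suc n))))"
    by (intro comeagre_INT_open_dense) simp_all
  moreover have "(\<Inter>n. U (inverse (real (Suc n)))) = {t. \<forall>e>0. \<exists>c\<in>J. apply_cfun (u c) t < e}"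
  proof (intro set_eqI iffI)
    fix t assume t: "t \<in> (\<Inter>n. U (inverse (real (Suc n))))"
    have "\<exists>c\<in>J. apply_cfun (u c) t < e" if "e > 0" for e
    proof -
      obtain n where n: "inverse (real (Suc n)) < e" using reals_Archimedean[OF \<open>e > 0\<close>] by blast
      obtain c where "c \<in> J" "apply_cfun (u c) t < inverse (real (Suc n))"
        using t by (auto simp: U_def)
      then show ?thesis using n by (meson less_trans)
    qed
    then show "t \<in> {t. \<forall>e>0. \<exists>c\<in>J. apply_cfun (u c) t < e}" by blast
  qed (simp add: U_def)
  ultimately show ?thesis by simp
qed

text \<open>
  Testing the uo-Cauchy property against the constant function \<open>1\<close> is enough, because
  \<open>min r 1 < min e 1\<close> forces \<open>r < e\<close>.
\<close>
lemma uo_Cauchy_cfun_imp_pointwise_convergent: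
  fixes f :: "'i \<Rightarrow> 'a::topological_space cfun"
  assumes cr: "completely_regular_space (euclidean :: 'a topology)"
    and dir: "directed_set I le" and Cauchy: "uo_Cauchy I le f"
  shows "\<exists>D. comeagre D \<and>
    (\<forall>t\<in>D. \<exists>L. ((\<lambda>a. apply_cfun (f a) t) \<longlongrightarrow> L) (net_filter I le))"
proof -
  define one :: "'a cfun" where "one = Cfun (\<lambda>_. 1)"
  have one: "apply_cfun one t = 1" for t by (simp add: one_def Cfun_inverse)
  then have "0 \<le> one" by (simp add: less_eq_cfun.rep_eq zero_cfun.rep_eq)
  then obtain J :: "'a cfun set" and le' u where u: "decreases_to_zero J le' u"
    and dom: "\<And>c. c \<in> J \<Longrightarrow> \<exists>p\<in>I \<times> I. \<forall>q\<in>I \<times> I. rel_prod le le p q \<longrightarrow>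
      \<bar>inf \<bar>(case q of (a, b) \<Rightarrow> f a - f b) - 0\<bar> one - 0\<bar> \<le> u c"
    using Cauchy unfolding uo_Cauchy_def uo_converges_def order_converges_def by blast
  define D where "D = {t. \<forall>e>0. \<exists>c\<in>J. apply_cfun (u c) t < e}"
  have "comeagre D"
    unfolding D_def by (rule decreases_to_zero_pointwise_comeagre[OF cr u])
  moreover have "\<exists>L. ((\<lambda>a. apply_cfun (f a) t) \<longlongrightarrow> L) (net_filter I le)" if t: "t \<in> D" for t
    unfolding convergent_net_iff_Cauchy[OF dir]
  proof (intro allI impI)
    fix e :: real assume "e > 0"
    then have "min e 1 > 0" by simp
    then obtain c where c: "c \<in> J" "apply_cfun (u c) t < min e 1"
      using t unfolding D_def by blast
    then obtain p where "p \<in> I \<times> I" and p: "\<forall>q\<in>I \<times> I. rel_prod le le p q \<longrightarrow>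
      \<bar>inf \<bar>(case q of (a, b) \<Rightarrow> f a - f b) - 0\<bar> one - 0\<bar> \<le> u c" using dom[OF c(1)] by blast
    from \<open>p \<in> I \<times> I\<close> obtain a0 b0 where p_eq: "p = (a0, b0)" "a0 \<in> I" "b0 \<in> I" by blast
    then obtain a where a: "a \<in> I" "le a0 a" "le b0 a"
      using dir unfolding directed_set_def by blast
    have trans: "transp_on I le" using dir by (simp add: directed_set_def)
    have "\<bar>apply_cfun (f b) t - apply_cfun (f d) t\<bar> < e"
      if bd: "b \<in> I" "d \<in> I" "le a b" "le a d" for b d
    proof -
      have "rel_prod le le p (b, d)"
        using bd a p_eq trans by (auto dest: transp_onD)
      then have "\<bar>inf \<bar>f b - f d\<bar> one\<bar> \<le> u c"
        using bspec[OF p, of "(b, d)"] bd by simp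
      then have "\<bar>min \<bar>apply_cfun (f b) t - apply_cfun (f d) t\<bar> 1\<bar> \<le> apply_cfun (u c) t"
        by (simp add: less_eq_cfun.rep_eq abs_cfun.rep_eq inf_cfun.rep_eq minus_cfun.rep_eq one)
      then show ?thesis using c(2) by linarith
    qed
    then show "\<exists>a\<in>I. \<forall>b\<in>I. \<forall>c\<in>I. le a b \<longrightarrow> le a c \<longrightarrow>
      \<bar>apply_cfun (f b) t - apply_cfun (f c) t\<bar> < e"
      using a(1) by blast
  qed
  ultimately show ?thesis by blast
qed

section \<open>From pointwise convergence to the uo-Cauchy property\<close>

text \<open>
  The suprema of the tails of \<open>|f b - f c|\<close> decrease to zero on \<open>D\<close> but are in general not
  continuous, so they cannot serve as dominators themselves. Taking instead all continuous functions
  above the truncated tails avoids choosing a dominator; the Baire property is what guarantees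
  that there are enough of them for the infimum to be zero.
\<close>
lemma pointwise_convergent_imp_uo_Cauchy_cfun:
  fixes f :: "'i \<Rightarrow> 'a::topological_space cfun"
  assumes cr: "completely_regular_space (euclidean :: 'a topology)"
    and baire: "baire_space TYPE('a)"
    and dir: "directed_set I le" and count: "countable I" and D: "comeagre D"
    and conv: "\<And>t. t \<in> D \<Longrightarrow> \<exists>L. ((\<lambda>a. apply_cfun (f a) t) \<longlongrightarrow> L) (net_filter I le)"
  shows "uo_Cauchy I le f"
  unfolding uo_Cauchy_def uo_converges_def
proof (intro allI impI)
  fix u :: "'a cfun" assume u: "0 \<le> u"
  define dominates where "dominates v a \<longleftrightarrow>
    (\<forall>b\<in>I. \<forall>c\<in>I. le a b \<longrightarrow> le a c \<longrightarrow> inf \<bar>f b - f c\<bar> u \<le> v)" for v a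
  define V where "V = {v. 0 \<le> v \<and> (\<exists>a\<in>I. dominates v a)}"
  have trans: "transp_on I le" using dir by (simp add: directed_set_def)
  have dirV: "directed_set V (\<lambda>v w. w \<le> v)"
    unfolding directed_set_def
  proof (intro conjI ballI)
    have "u \<in> V" using u dir by (auto simp: V_def dominates_def directed_set_def)
    then show "V \<noteq> {}" by blast
    show "reflp_on V (\<lambda>v w. w \<le> v)" by (simp add: reflp_on_def)
    show "transp_on V (\<lambda>v w. w \<le> v)" by (auto simp: transp_on_def)
    fix v w assume vw: "v \<in> V" "w \<in> V"
    then obtain a b where ab: "a \<in> I" "dominates v a" "b \<in> I" "dominates w b"
      by (auto simp: V_def)
    then obtain c where c: "c \<in> I" "le a c" "le b c"
      using dir unfolding directed_set_def by blast
    have "le a d \<and> le b d" if "d \<in> I" "le c d" for d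
      using transp_onD[OF trans] ab c that by blast
    then have "dominates (inf v w) c"
      using ab(2,4) unfolding dominates_def by (simp add: le_infI)
    then have "inf v w \<in> V" using vw c by (auto simp: V_def)
    then show "\<exists>z\<in>V. z \<le> v \<and> z \<le> w" by (intro bexI[of _ "inf v w"]) simp_all
  qed
  have "z \<le> 0" if z: "\<And>v. v \<in> V \<Longrightarrow> z \<le> v" for z
  proof (rule ccontr)
    assume "\<not> z \<le> 0"
    then obtain t where t: "apply_cfun z t > 0"
      by (auto simp: less_eq_cfun.rep_eq zero_cfun.rep_eq not_le)
    \<comment> \<open>The value of \<open>e\<close> only has to lie strictly between \<open>0\<close> and \<open>z t\<close>, so that \<open>z > e\<close> on a
      whole neighbourhood of \<open>t\<close>.\<close>
    define e where "e = apply_cfun z t / 2"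
    have e: "e > 0" "e < apply_cfun z t" using t by (simp_all add: e_def)
    define W where "W = {s. e < apply_cfun z s}"
    have W: "open W" "t \<in> W"
      using e unfolding W_def by (auto intro!: open_Collect_less continuous_intros)
    define F where "F a = {s. \<forall>b\<in>I. \<forall>c\<in>I. le a b \<longrightarrow> le a c \<longrightarrow>
      \<bar>apply_cfun (f b) s - apply_cfun (f c) s\<bar> \<le> e}" for a
    have "closed (F a)" for a
    proof -
      have "F a = (\<Inter>b\<in>{b\<in>I. le a b}. \<Inter>c\<in>{c\<in>I. le a c}.
          {s. \<bar>apply_cfun (f b) s - apply_cfun (f c) s\<bar> \<le> e})"
        unfolding F_def by blast
      then show ?thesis
        by (auto intro!: closed_INT closed_Collect_le continuous_intros)
    qed
    moreover have "D \<subseteq> (\<Union>a\<in>I. F a)"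
    proof
      fix s assume "s \<in> D"
      then obtain a where "a \<in> I" "\<forall>b\<in>I. \<forall>c\<in>I. le a b \<longrightarrow> le a c \<longrightarrow>
        \<bar>apply_cfun (f b) s - apply_cfun (f c) s\<bar> < e"
        using conv e(1) unfolding convergent_net_iff_Cauchy[OF dir] by blast
      then show "s \<in> (\<Union>a\<in>I. F a)" unfolding F_def by (auto intro: less_imp_le)
    qed
    ultimately have "closure (\<Union>a\<in>I. interior (F a)) = UNIV"
      using baire_closed_cover[OF baire D count] by blast
    then have "W \<inter> (\<Union>a\<in>I. interior (F a)) \<noteq> {}"
      using W open_Int_closure_eq_empty by blast
    then obtain a s where a: "a \<in> I" and s: "s \<in> W" "s \<in> interior (F a)" by blast
    obtain g where g: "\<And>r. 0 \<le> apply_cfun g r" "\<And>r. apply_cfun g r \<le> 1"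
      "apply_cfun g s = 1" "\<And>r. r \<notin> interior (F a) \<Longrightarrow> apply_cfun g r = 0"
      using completely_regular_bump[OF cr open_interior s(2)] by blast
    \<comment> \<open>On the interior of \<open>F a\<close> the summand \<open>e\<close> already dominates the tail; elsewhere \<open>g\<close> vanishes
      and the summand \<open>u\<close> dominates it because of the truncation.\<close>
    define v where "v = Cfun (\<lambda>r. e + apply_cfun u r * (1 - apply_cfun g r))"
    have "continuous_on UNIV (\<lambda>r. e + apply_cfun u r * (1 - apply_cfun g r))"
      by (intro continuous_intros continuous_on_apply_cfun)
    then have v: "apply_cfun v r = e + apply_cfun u r * (1 - apply_cfun g r)" for r
      by (simp add: v_def Cfun_inverse)
    have u_nonneg: "0 \<le> apply_cfun u r" for r
      using u by (simp add: less_eq_cfun.rep_eq zero_cfun.rep_eq)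
    have v_ge: "e \<le> apply_cfun v r" for r
      using g(2)[of r] u_nonneg[of r] by (simp add: v)
    have "dominates v a"
      unfolding dominates_def
    proof (intro ballI impI)
      fix b c assume bc: "b \<in> I" "c \<in> I" "le a b" "le a c"
      have "min \<bar>apply_cfun (f b) r - apply_cfun (f c) r\<bar> (apply_cfun u r) \<le> apply_cfun v r" for r
      proof (cases "r \<in> interior (F a)")
        case True
        then have "r \<in> F a" using interior_subset by blast
        then have "\<bar>apply_cfun (f b) r - apply_cfun (f c) r\<bar> \<le> e"
          using bc by (simp add: F_def)
        then show ?thesis using v_ge[of r] by linarith
      next
        case False
        then show ?thesis using g(4)[of r] e(1) by (simp add: v)
      qed
      then show "inf \<bar>f b - f c\<bar> u \<le> v"
        by (simp add: less_eq_cfun.rep_eq inf_cfun.rep_eq abs_cfun.rep_eq minus_cfun.rep_eq)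
    qed
    moreover have "0 \<le> v"
      using v_ge e(1) by (simp add: less_eq_cfun.rep_eq zero_cfun.rep_eq) (meson less_imp_le order_trans)
    ultimately have "z \<le> v" using z a by (auto simp: V_def)
    then have "apply_cfun z s \<le> apply_cfun v s" by (simp add: less_eq_cfun.rep_eq)
    then show False using s(1) g(3) by (simp add: W_def v)
  qed
  then have decV: "decreases_to_zero V (\<lambda>v w. w \<le> v) (\<lambda>v. v)"
    by (auto simp: decreases_to_zero_def V_def)
  show "order_converges (I \<times> I) (rel_prod le le)
    (\<lambda>p. inf \<bar>(case p of (a, b) \<Rightarrow> f a - f b) - 0\<bar> u) 0"
  proof (rule order_convergesI[OF dirV decV])
    fix v assume "v \<in> V"
    then obtain a where a: "a \<in> I" "dominates v a" by (auto simp: V_def)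
    then show "\<exists>p\<in>I \<times> I. \<forall>q\<in>I \<times> I. rel_prod le le p q \<longrightarrow>
      \<bar>inf \<bar>(case q of (a, b) \<Rightarrow> f a - f b) - 0\<bar> u - 0\<bar> \<le> v"
      using u by (intro bexI[of _ "(a, a)"]) (auto simp: dominates_def abs_of_nonneg)
  qed
qed

theorem corollary3p10:
  fixes I :: "'i set" and le :: "'i \<Rightarrow> 'i \<Rightarrow> bool" and f :: "'i \<Rightarrow> 'a::t2_space cfun"
  assumes "completely_regular_space (euclidean :: 'a topology)"
    and "baire_space TYPE('a)"
    and "directed_set I le"
  shows "(uo_Cauchy I le f \<longrightarrow>
           (\<exists>D. comeagre D \<and>
             (\<forall>t\<in>D. \<exists>L::real. ((\<lambda>a. apply_cfun (f a) t) \<longlongrightarrow> L) (net_filter I le)))) \<and>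
         (countable I \<longrightarrow>
           (\<exists>D. comeagre D \<and>
             (\<forall>t\<in>D. \<exists>L::real. ((\<lambda>a. apply_cfun (f a) t) \<longlongrightarrow> L) (net_filter I le))) \<longrightarrow>
           uo_Cauchy I le f)"
  using uo_Cauchy_cfun_imp_pointwise_convergent[OF assms(1,3)]
    pointwise_convergent_imp_uo_Cauchy_cfun[OF assms] by blast

end
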